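(* Consider the equation $w_xE_x+w_yE_y+E(w_{xx}+w_{yy})=-1$ with $w=w(x,y)$ and $E=E(x,y)$ both dependent variables, and a nonclassical generator $\mathcal U=\xi\,\partial_x+\partial_y+\phi\,\partial_w+\psi\,\partial_E$ of this equation with $\xi=A(x,y)$ and $\phi=G(x,y,w)$. If $A(x,y)=k$ with $k\neq 0$ a constant and $G(x,y,w)=(k^2+1)(kx+y)\mu(w)$, where $\mu$ is an arbitrary nonconstant function, then the nonclassical generator is $$\mathcal U=k\,\partial_x+\partial_y+(k^2+1)(kx+y)\mu(w)\,\partial_w-(k^2+1)(kx+y)\mu'(w)E\,\partial_E .$$
   Context: All functions are assumed real analytic on open domains, and $E\neq 0$. Put $F=w_xE_x+w_yE_y+E(w_{xx}+w_{yy})+1$ on the second-order jet space with independent variables $x,y$ and dependent variables $w,E$. For a vector field $\mathcal U=\xi\,\partial_x+\partial_y+\phi\,\partial_w+\psi\,\partial_E$ with $\xi,\phi,\psi$ functions of $(x,y,w,E)$ (the coefficient of $\partial_y$ is normalized to $1$), put $\phi_1=\xi w_x+w_y-\phi$ and $\phi_2=\xi E_x+E_y-\psi$. $\mathcal U$ is called a nonclassical generator (generator of a nonclassical equivalence transformation, or conditional symmetry) of the equation $F=0$ if $\mathrm{pr}^{(2)}\mathcal U(F)=0$, $\mathrm{pr}^{(1)}\mathcal U(\phi_1)=0$ and $\mathrm{pr}^{(1)}\mathcal U(\phi_2)=0$ at all jet points where $F=0$, $\phi_1=\phi_2=0$, and the total derivatives of $\phi_1,\phi_2$ with respect to $x$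 and $y$ vanish. Here $\mathrm{pr}^{(n)}\mathcal U$ is the usual $n$-th prolongation ($x,y$ independent, $w,E$ dependent). A statement that "the nonclassical generator" with prescribed $\xi$ and $\phi$ is a given vector field means that this vector field is a nonclassical generator and is the one with those $\xi,\phi$. *)

theory Defs
  imports "HOL-Analysis.Analysis"
begin

text \<open>Real analyticity: near every point of \<open>S\<close> the function is the sum of an (absolutely)
  convergent power series. The multi-indices are the functions \<open>Basis \<rightarrow>\<^sub>E UNIV\<close>.\<close>

definition real_analytic_on :: "('a::euclidean_space \<Rightarrow> real) \<Rightarrow> 'a set \<Rightarrow> bool"
    (infixl \<open>real'_analytic'_on\<close> 50) where
  "f real_analytic_on S \<longleftrightarrow>
     (\<forall>p\<in>S. \<exists>r>0. \<exists>c :: ('a \<Rightarrow> nat) \<Rightarrow> real. \<forall>q\<in>ball p r.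
        ((\<lambda>\<alpha>. c \<alpha> * (\<Prod>b\<in>Basis. ((q - p) \<bullet> b) ^ \<alpha> b)) has_sum f q) (Basis \<rightarrow>\<^sub>E UNIV))"

text \<open>Coordinates of the second-order jet space with independent variables \<open>x\<close>, \<open>y\<close> and
  dependent variables \<open>w\<close>, \<open>E\<close>; for instance \<open>jwxy\<close> stands for the coordinate \<open>w\<^sub>x\<^sub>y\<close>.\<close>

datatype jet_coord =
    jx | jy | jw | jE
  | jwx | jwy | jEx | jEy
  | jwxx | jwxy | jwyy | jExx | jExy | jEyy

type_synonym jet = "jet_coord \<Rightarrow> real"
type_synonym base_point = "real \<times> real \<times> real \<times> real"

definition base :: "jet \<Rightarrow> base_point" where
  "base J = (J jx, J jy, J jw, J jE)"

definition partial :: "jet_coord \<Rightarrow> (jet \<Rightarrow> real) \<Rightarrow> jet \<Rightarrow> real" where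
  "partial c f J = deriv (\<lambda>t. f (J(c := t))) (J c)"

text \<open>Total derivatives. Third-order coordinates are not present, so these are the total
  derivatives only of functions \<open>f\<close> that depend on jet coordinates of order at most one;
  they are not applied to any other functions below.\<close>

definition total_dx :: "(jet \<Rightarrow> real) \<Rightarrow> jet \<Rightarrow> real" where
  "total_dx f J = partial jx f J + J jwx * partial jw f J + J jEx * partial jE f J
     + J jwxx * partial jwx f J + J jwxy * partial jwy f J
     + J jExx * partial jEx f J + J jExy * partial jEy f J"

definition total_dy :: "(jet \<Rightarrow> real) \<Rightarrow> jet \<Rightarrow> real" where
  "total_dy f J = partial jy f J + J jwy * partial jw f J + J jEy * partial jE f J
     + J jwxy * partial jwx f J + J jwyy * partial jwy f J
     + J jExy * partial jEx f J + J jEyy * partial jEy f J"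

text \<open>One step of the recursion for the coefficients of a prolonged vector field
  \<open>\<xi> \<partial>\<^sub>x + \<eta> \<partial>\<^sub>y + \<dots>\<close>: if \<open>\<zeta>\<close> is the coefficient belonging to a jet coordinate \<open>u\<close>, and
  \<open>ux\<close>, \<open>uy\<close> are the \<open>x\<close>- and \<open>y\<close>-derivative coordinates of \<open>u\<close>, then
  \<open>D \<zeta> - ux D \<xi> - uy D \<eta>\<close> is the coefficient belonging to the derivative of \<open>u\<close> along \<open>D\<close>
  (\<open>D\<close> being \<open>total_dx\<close> or \<open>total_dy\<close>).\<close>

definition prolong_coeff ::
    "((jet \<Rightarrow> real) \<Rightarrow> jet \<Rightarrow> real) \<Rightarrow> (jet \<Rightarrow> real) \<Rightarrow> (jet \<Rightarrow> real) \<Rightarrow> (jet \<Rightarrow> real)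
       \<Rightarrow> jet_coord \<Rightarrow> jet_coord \<Rightarrow> jet \<Rightarrow> real" where
  "prolong_coeff D \<xi> \<eta> \<zeta> ux uy J = D \<zeta> J - J ux * D \<xi> J - J uy * D \<eta> J"

definition pr1 :: "(base_point \<Rightarrow> real) \<Rightarrow> (base_point \<Rightarrow> real) \<Rightarrow> (base_point \<Rightarrow> real)
    \<Rightarrow> (base_point \<Rightarrow> real) \<Rightarrow> (jet \<Rightarrow> real) \<Rightarrow> jet \<Rightarrow> real" where
  "pr1 \<xi> \<eta> \<phi> \<psi> f J =
    (let pc = (\<lambda>D. prolong_coeff D (\<xi> \<circ> base) (\<eta> \<circ> base));
         \<phi>x = pc total_dx (\<phi> \<circ> base) jwx jwy;
         \<phi>y = pc total_dy (\<phi> \<circ> base) jwx jwy;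
         \<psi>x = pc total_dx (\<psi> \<circ> base) jEx jEy;
         \<psi>y = pc total_dy (\<psi> \<circ> base) jEx jEy
     in \<xi> (base J) * partial jx f J + \<eta> (base J) * partial jy f J
      + \<phi> (base J) * partial jw f J + \<psi> (base J) * partial jE f J
      + \<phi>x J * partial jwx f J + \<phi>y J * partial jwy f J
      + \<psi>x J * partial jEx f J + \<psi>y J * partial jEy f J)"

definition pr2 :: "(base_point \<Rightarrow> real) \<Rightarrow> (base_point \<Rightarrow> real) \<Rightarrow> (base_point \<Rightarrow> real)
    \<Rightarrow> (base_point \<Rightarrow> real) \<Rightarrow> (jet \<Rightarrow> real) \<Rightarrow> jet \<Rightarrow> real" where
  "pr2 \<xi> \<eta> \<phi> \<psi> f J =
    (let pc = (\<lambda>D. prolong_coeff D (\<xi> \<circ> base) (\<eta> \<circ> base));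
         \<phi>x = pc total_dx (\<phi> \<circ> base) jwx jwy;
         \<phi>y = pc total_dy (\<phi> \<circ> base) jwx jwy;
         \<psi>x = pc total_dx (\<psi> \<circ> base) jEx jEy;
         \<psi>y = pc total_dy (\<psi> \<circ> base) jEx jEy;
         \<phi>xx = pc total_dx \<phi>x jwxx jwxy;
         \<phi>xy = pc total_dy \<phi>x jwxx jwxy;
         \<phi>yy = pc total_dy \<phi>y jwxy jwyy;
         \<psi>xx = pc total_dx \<psi>x jExx jExy;
         \<psi>xy = pc total_dy \<psi>x jExx jExy;
         \<psi>yy = pc total_dy \<psi>y jExy jEyy
     in pr1 \<xi> \<eta> \<phi> \<psi> f J
      + \<phi>xx J * partial jwxx f J + \<phi>xy J * partial jwxy f J + \<phi>yy J * partial jwyy f J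
      + \<psi>xx J * partial jExx f J + \<psi>xy J * partial jExy f J + \<psi>yy J * partial jEyy f J)"

definition pde :: "jet \<Rightarrow> real" where
  "pde J = J jwx * J jEx + J jwy * J jEy + J jE * (J jwxx + J jwyy) + 1"

definition surf_w :: "(base_point \<Rightarrow> real) \<Rightarrow> (base_point \<Rightarrow> real) \<Rightarrow> jet \<Rightarrow> real" where
  "surf_w \<xi> \<phi> J = \<xi> (base J) * J jwx + J jwy - \<phi> (base J)"

definition surf_E :: "(base_point \<Rightarrow> real) \<Rightarrow> (base_point \<Rightarrow> real) \<Rightarrow> jet \<Rightarrow> real" where
  "surf_E \<xi> \<psi> J = \<xi> (base J) * J jEx + J jEy - \<psi> (base J)"

text \<open>The vector field \<open>\<xi> \<partial>\<^sub>x + \<partial>\<^sub>y + \<phi> \<partial>\<^sub>w + \<psi> \<partial>\<^sub>E\<close> on the open set \<open>\<Omega>\<close> of \<open>(x, y, w, E)\<close>-space;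
  values of the coefficients outside \<open>\<Omega>\<close> are irrelevant.\<close>

definition nonclassical_generator ::
    "base_point set \<Rightarrow> (base_point \<Rightarrow> real) \<Rightarrow> (base_point \<Rightarrow> real) \<Rightarrow> (base_point \<Rightarrow> real) \<Rightarrow> bool"
  where
  "nonclassical_generator \<Omega> \<xi> \<phi> \<psi> \<longleftrightarrow>
     open \<Omega> \<and> (\<forall>(x, y, w, E)\<in>\<Omega>. E \<noteq> 0) \<and>
     \<xi> real_analytic_on \<Omega> \<and> \<phi> real_analytic_on \<Omega> \<and> \<psi> real_analytic_on \<Omega> \<and>
     (\<forall>J. base J \<in> \<Omega> \<and> pde J = 0 \<and> surf_w \<xi> \<phi> J = 0 \<and> surf_E \<xi> \<psi> J = 0 \<and>
        total_dx (surf_w \<xi> \<phi>) J = 0 \<and> total_dy (surf_w \<xi> \<phi>) J = 0 \<and>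
        total_dx (surf_E \<xi> \<psi>) J = 0 \<and> total_dy (surf_E \<xi> \<psi>) J = 0 \<longrightarrow>
        pr2 \<xi> (\<lambda>_. 1) \<phi> \<psi> pde J = 0 \<and>
        pr1 \<xi> (\<lambda>_. 1) \<phi> \<psi> (surf_w \<xi> \<phi>) J = 0 \<and>
        pr1 \<xi> (\<lambda>_. 1) \<phi> \<psi> (surf_E \<xi> \<psi>) J = 0)"

end

theory Submission
  imports Defs
begin

text \<open>Write \<open>c = k\<^sup>2 + 1\<close> and \<open>s = k x + y\<close>. On the invariant surfaces \<open>w\<^sub>y = \<phi> - k w\<^sub>x\<close>,
  \<open>E\<^sub>y = \<psi> - k E\<^sub>x\<close>, the differentiated surface equations together with the PDE fix \<open>w\<^sub>x\<^sub>x\<close> (its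
  coefficient is \<open>c E \<noteq> 0\<close>), while \<open>w\<^sub>x\<close> and \<open>E\<^sub>x\<close> stay free. The invariance condition is a
  polynomial in these two: the coefficient of \<open>w\<^sub>x E\<^sub>x\<close> gives \<open>\<psi>\<^sub>E = \<psi> / E\<close>, so \<open>\<psi>\<close> is locally
  \<open>E\<close> times a function of \<open>(x, y, w)\<close>; the constant term is then affine in \<open>E\<close>, and its part of
  degree \<open>0\<close> reads \<open>\<psi> / E + c s \<mu>' = 0\<close>. Conversely, for this \<open>\<psi>\<close> the condition holds identically
  on the invariant surfaces.\<close>

subsection \<open>Real analytic functions\<close>

text \<open>Names the expansion inside \<open>real_analytic_on\<close>, so that radius and
  coefficients can be fixed and recombined. The sum is unordered, so multi-indices need no
  enumeration.\<close>

definition power_series_on_ball ::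
    "('a::euclidean_space \<Rightarrow> real) \<Rightarrow> 'a \<Rightarrow> real \<Rightarrow> (('a \<Rightarrow> nat) \<Rightarrow> real) \<Rightarrow> bool" where
  "power_series_on_ball f p r c \<longleftrightarrow> (\<forall>q\<in>ball p r.
     ((\<lambda>\<alpha>. c \<alpha> * (\<Prod>b\<in>Basis. ((q - p) \<bullet> b) ^ \<alpha> b)) has_sum f q) (Basis \<rightarrow>\<^sub>E UNIV))"

lemma real_analytic_on_iff:
  "f real_analytic_on S \<longleftrightarrow> (\<forall>p\<in>S. \<exists>r>0. \<exists>c. power_series_on_ball f p r c)"
  unfolding real_analytic_on_def power_series_on_ball_def ..

lemma power_series_on_ballD:
  "power_series_on_ball f p r c \<Longrightarrow> q \<in> ball p r \<Longrightarrow>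
    ((\<lambda>\<alpha>. c \<alpha> * (\<Prod>b\<in>Basis. ((q - p) \<bullet> b) ^ \<alpha> b)) has_sum f q) (Basis \<rightarrow>\<^sub>E UNIV)"
  unfolding power_series_on_ball_def by (rule bspec)

lemma power_series_on_ballI:
  "(\<And>q. q \<in> ball p r \<Longrightarrow> ((\<lambda>\<alpha>. c \<alpha> * (\<Prod>b\<in>Basis. ((q - p) \<bullet> b) ^ \<alpha> b)) has_sum f q) (Basis \<rightarrow>\<^sub>E UNIV)) \<Longrightarrow>
    power_series_on_ball f p r c"
  unfolding power_series_on_ball_def by (rule ballI)

text \<open>The exponent of a pure power of the \<open>b\<close>-coordinate. It is restricted to
  \<open>Basis\<close> because multi-indices are extensional: off \<open>Basis\<close> they take the
  value \<open>undefined\<close>.\<close>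

definition axis_index :: "'a::euclidean_space \<Rightarrow> nat \<Rightarrow> 'a \<Rightarrow> nat" where
  "axis_index b n = (\<lambda>b'\<in>Basis. if b' = b then n else 0)"

lemma axis_index_in: "axis_index b n \<in> Basis \<rightarrow>\<^sub>E UNIV"
  by (simp add: axis_index_def)

lemma axis_index_same [simp]: "b \<in> Basis \<Longrightarrow> axis_index b n b = n"
  by (simp add: axis_index_def)

lemma inj_axis_index: "b \<in> Basis \<Longrightarrow> inj (axis_index b)"
  by (rule injI) (metis axis_index_same)

lemma monomial_axis_index:
  fixes b v :: "'a::euclidean_space"
  assumes "b \<in> Basis"
  shows "(\<Prod>b'\<in>Basis. (v \<bullet> b') ^ axis_index b n b') = (v \<bullet> b) ^ n"
proof -
  have "(\<Prod>b'\<in>Basis. (v \<bullet> b') ^ axis_index b n b') = (\<Prod>b'\<in>Basis. if b' = b then (v \<bullet> b') ^ n else 1)"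
    by (intro prod.cong) (auto simp: axis_index_def)
  then show ?thesis
    using assms by simp
qed

lemma not_axis_index:
  fixes b :: "'a::euclidean_space"
  assumes "\<alpha> \<in> Basis \<rightarrow>\<^sub>E UNIV" "\<alpha> \<notin> range (axis_index b)"
  obtains b' where "b' \<in> Basis" "b' \<noteq> b" "\<alpha> b' \<noteq> 0"
proof -
  have "\<alpha> = axis_index b (\<alpha> b)" if "\<forall>b'\<in>Basis. b' \<noteq> b \<longrightarrow> \<alpha> b' = 0"
    using assms(1) that by (auto simp: axis_index_def fun_eq_iff PiE_def extensional_def)
  then show ?thesis
    using assms(2) that by blast
qed

text \<open>Zero terms do not affect an unordered sum, and the remaining ones are reindexed along
  the injective \<open>axis_index b\<close>. The off-axis terms vanish because of \<open>v\<close>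
  when a function is restricted to a line, and because of \<open>c\<close> when a one-variable
  series is lifted.\<close>

lemma has_sum_axis_index_iff:
  fixes b v :: "'a::euclidean_space"
  assumes "b \<in> Basis"
    and "\<And>\<alpha>. \<alpha> \<in> Basis \<rightarrow>\<^sub>E UNIV \<Longrightarrow> \<alpha> \<notin> range (axis_index b) \<Longrightarrow>
           c \<alpha> * (\<Prod>b\<in>Basis. (v \<bullet> b) ^ \<alpha> b) = (0::real)"
  shows "((\<lambda>\<alpha>. c \<alpha> * (\<Prod>b\<in>Basis. (v \<bullet> b) ^ \<alpha> b)) has_sum s) (Basis \<rightarrow>\<^sub>E UNIV) \<longleftrightarrow>
         ((\<lambda>n. c (axis_index b n) * (v \<bullet> b) ^ n) has_sum s) UNIV"
proof -
  let ?f = "\<lambda>\<alpha>. c \<alpha> * (\<Prod>b\<in>Basis. (v \<bullet> b) ^ \<alpha> b)"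
  have "(?f has_sum s) (Basis \<rightarrow>\<^sub>E UNIV) \<longleftrightarrow> (?f has_sum s) (range (axis_index b))"
    by (rule has_sum_cong_neutral) (use assms(2) axis_index_in in blast)+
  also have "\<dots> \<longleftrightarrow> ((?f \<circ> axis_index b) has_sum s) UNIV"
    by (intro has_sum_reindex inj_axis_index assms(1))
  finally show ?thesis
    by (simp add: o_def monomial_axis_index[OF assms(1)])
qed

text \<open>The displacement \<open>t *\<^sub>R b\<close> has only a \<open>b\<close>-coordinate, so
  every monomial involving another coordinate vanishes and a one-variable series remains.\<close>

lemma real_analytic_on_line:
  fixes f :: "'a::euclidean_space \<Rightarrow> real"
  assumes "f real_analytic_on S" "p \<in> S" "b \<in> Basis"
  shows "\<exists>r>0. \<exists>d. \<forall>t. \<bar>t\<bar> < r \<longrightarrow>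
    ((\<lambda>n. d n * t ^ n) has_sum f (p + t *\<^sub>R b)) (UNIV :: nat set)"
proof -
  obtain r c where r: "r > 0" and c: "power_series_on_ball f p r c"
    using assms(1,2) unfolding real_analytic_on_iff by blast
  have "((\<lambda>n. c (axis_index b n) * t ^ n) has_sum f (p + t *\<^sub>R b)) UNIV" if "\<bar>t\<bar> < r" for t
  proof -
    let ?v = "t *\<^sub>R b"
    have "p + ?v \<in> ball p r"
      using that assms(3) by (simp add: dist_norm)
    from power_series_on_ballD[OF c this]
    have "((\<lambda>\<alpha>. c \<alpha> * (\<Prod>b\<in>Basis. (?v \<bullet> b) ^ \<alpha> b)) has_sum f (p + ?v)) (Basis \<rightarrow>\<^sub>E UNIV)"
      by simp
    moreover have "(\<Prod>b\<in>Basis. (?v \<bullet> b) ^ \<alpha> b) = 0"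
      if \<alpha>: "\<alpha> \<in> Basis \<rightarrow>\<^sub>E UNIV" "\<alpha> \<notin> range (axis_index b)" for \<alpha>
    proof -
      obtain b' where "b' \<in> Basis" "b' \<noteq> b" "\<alpha> b' \<noteq> 0"
        using not_axis_index[OF \<alpha>] .
      then show ?thesis
        using assms(3) by (intro prod_zero bexI[of _ b']) (auto simp: inner_Basis)
    qed
    ultimately have "((\<lambda>n. c (axis_index b n) * (?v \<bullet> b) ^ n) has_sum f (p + ?v)) UNIV"
      by (subst (asm) has_sum_axis_index_iff[OF assms(3)]) auto
    then show ?thesis
      using assms(3) by simp
  qed
  with r show ?thesis
    by (intro exI[of _ r] conjI exI[of _ "\<lambda>n. c (axis_index b n)"] allI impI)
qed

text \<open>The one-variable series is read as a series with coefficients supported on the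
  \<open>b\<close>-axis. The radius is kept, since a coordinate is bounded by the norm.\<close>

lemma real_analytic_on_coordI:
  fixes h :: "real \<Rightarrow> real" and b :: "'a::euclidean_space"
  assumes "b \<in> Basis"
    and "\<And>p. p \<in> S \<Longrightarrow> \<exists>r>0. \<exists>d. \<forall>t. \<bar>t\<bar> < r \<longrightarrow>
           ((\<lambda>n. d n * t ^ n) has_sum h (p \<bullet> b + t)) (UNIV :: nat set)"
  shows "(\<lambda>q. h (q \<bullet> b)) real_analytic_on S"
  unfolding real_analytic_on_iff
proof
  fix p assume "p \<in> S"
  then obtain r d where r: "r > 0" and d: "\<And>t. \<bar>t\<bar> < r \<Longrightarrow>
      ((\<lambda>n. d n * t ^ n) has_sum h (p \<bullet> b + t)) (UNIV :: nat set)"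
    using assms(2) by blast
  define c where "c \<alpha> = (if \<alpha> \<in> range (axis_index b) then d (\<alpha> b) else 0)" for \<alpha>
  have "power_series_on_ball (\<lambda>q. h (q \<bullet> b)) p r c"
  proof (rule power_series_on_ballI)
    fix q assume "q \<in> ball p r"
    then have "\<bar>(q - p) \<bullet> b\<bar> < r"
      using Basis_le_norm[OF assms(1), of "q - p"] by (simp add: dist_norm norm_minus_commute)
    from d[OF this]
    show "((\<lambda>\<alpha>. c \<alpha> * (\<Prod>b\<in>Basis. ((q - p) \<bullet> b) ^ \<alpha> b)) has_sum h (q \<bullet> b)) (Basis \<rightarrow>\<^sub>E UNIV)"
      by (subst has_sum_axis_index_iff[OF assms(1)])
        (auto simp: c_def assms(1) inner_diff_left)
  qed
  with r show "\<exists>r>0. \<exists>c. power_series_on_ball (\<lambda>q. h (q \<bullet> b)) p r c"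
    by blast
qed

lemma real_analytic_on_compose_coord:
  fixes h :: "real \<Rightarrow> real" and b :: "'a::euclidean_space"
  assumes "h real_analytic_on I" "b \<in> Basis" "\<And>p. p \<in> S \<Longrightarrow> p \<bullet> b \<in> I"
  shows "(\<lambda>q. h (q \<bullet> b)) real_analytic_on S"
proof (rule real_analytic_on_coordI[OF assms(2)])
  fix p assume "p \<in> S"
  show "\<exists>r>0. \<exists>d. \<forall>t. \<bar>t\<bar> < r \<longrightarrow>
      ((\<lambda>n. d n * t ^ n) has_sum h (p \<bullet> b + t)) (UNIV :: nat set)"
    using real_analytic_on_line[OF assms(1) assms(3)[OF \<open>p \<in> S\<close>], of 1] by simp
qed

section \<open>Closure properties of real analytic functions\<close>

lemma real_analytic_on_const: "(\<lambda>_ :: 'a::euclidean_space. a) real_analytic_on S"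
proof (rule real_analytic_on_coordI[OF SOME_Basis, of _ "\<lambda>_. a"])
  \<comment> \<open>A constant counts as a function of an arbitrary coordinate, with a series
    consisting of its term at 0.\<close>
  have "((\<lambda>n. (if n = 0 then a else 0) * t ^ n) has_sum a) (UNIV :: nat set)" for t
    by (rule has_sum_finite_neutralI[of "{0}"]) auto
  then show "\<exists>r>0. \<exists>d. \<forall>t. \<bar>t\<bar> < r \<longrightarrow> ((\<lambda>n. d n * t ^ n) has_sum a) (UNIV :: nat set)"
    by (intro exI[of _ 1] conjI exI[of _ "\<lambda>n. if n = 0 then a else 0"]) auto
qed

lemma real_analytic_on_add:
  assumes "f real_analytic_on S" "g real_analytic_on S"
  shows "(\<lambda>q. f q + g q) real_analytic_on S"
  unfolding real_analytic_on_iff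
proof
  fix p assume "p \<in> S"
  then obtain r c r' c' where r: "r > 0" "r' > 0"
    and c: "power_series_on_ball f p r c" "power_series_on_ball g p r' c'"
    using assms unfolding real_analytic_on_iff by blast
  have "power_series_on_ball (\<lambda>q. f q + g q) p (min r r') (\<lambda>\<alpha>. c \<alpha> + c' \<alpha>)"
    unfolding power_series_on_ball_def distrib_right
    by (intro ballI has_sum_add power_series_on_ballD[OF c(1)] power_series_on_ballD[OF c(2)]) simp_all
  with r show "\<exists>r>0. \<exists>c. power_series_on_ball (\<lambda>q. f q + g q) p r c"
    by (metis min_less_iff_conj)
qed

lemma real_analytic_on_cmult:
  assumes "f real_analytic_on S"
  shows "(\<lambda>q. a * f q) real_analytic_on S"
  unfolding real_analytic_on_iff
proof
  fix p assume "p \<in> S"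
  then obtain r c where r: "r > 0" and c: "power_series_on_ball f p r c"
    using assms unfolding real_analytic_on_iff by blast
  have "power_series_on_ball (\<lambda>q. a * f q) p r (\<lambda>\<alpha>. a * c \<alpha>)"
    unfolding power_series_on_ball_def mult.assoc
    by (intro ballI has_sum_cmult_right power_series_on_ballD[OF c])
  with r show "\<exists>r>0. \<exists>c. power_series_on_ball (\<lambda>q. a * f q) p r c"
    by blast
qed

text \<open>Multiplication by a coordinate raises the exponent at \<open>b\<close> by one, which is
  the injective map \<open>up\<close> on multi-indices. Its image omits exactly the indices with
  exponent 0 at \<open>b\<close>, where the new coefficient is 0.\<close>

lemma has_sum_monomial_shift:
  fixes b v :: "'a::euclidean_space"
  assumes "b \<in> Basis"
    and "((\<lambda>\<alpha>. c \<alpha> * (\<Prod>b\<in>Basis. (v \<bullet> b) ^ \<alpha> b)) has_sum s) (Basis \<rightarrow>\<^sub>E UNIV)"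
  shows "((\<lambda>\<alpha>. (if \<alpha> b = 0 then 0 else c (\<alpha>(b := \<alpha> b - 1))) * (\<Prod>b\<in>Basis. (v \<bullet> b) ^ \<alpha> b))
      has_sum ((v \<bullet> b) * s)) (Basis \<rightarrow>\<^sub>E UNIV)"
proof -
  let ?P = "Basis \<rightarrow>\<^sub>E (UNIV :: nat set)" and ?m = "\<lambda>\<alpha>. \<Prod>b\<in>Basis. (v \<bullet> b) ^ \<alpha> b"
  define c' where "c' \<alpha> = (if \<alpha> b = 0 then 0 else c (\<alpha>(b := \<alpha> b - 1)))" for \<alpha> :: "'a \<Rightarrow> nat"
  define up where "up \<alpha> = \<alpha>(b := Suc (\<alpha> b))" for \<alpha> :: "'a \<Rightarrow> nat"
  have inj: "inj_on up ?P"
  proof (rule inj_onI)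
    fix \<alpha> \<beta> assume "up \<alpha> = up \<beta>"
    then have "(up \<alpha>)(b := up \<alpha> b - 1) = (up \<beta>)(b := up \<beta> b - 1)" by simp
    then show "\<alpha> = \<beta>" by (simp add: up_def)
  qed
  have m: "?m (up \<alpha>) = (v \<bullet> b) * ?m \<alpha>" for \<alpha>
  proof -
    have "(\<Prod>b'\<in>Basis - {b}. (v \<bullet> b') ^ up \<alpha> b') = (\<Prod>b'\<in>Basis - {b}. (v \<bullet> b') ^ \<alpha> b')"
      by (intro prod.cong) (auto simp: up_def)
    then show ?thesis
      using assms(1) by (simp add: prod.remove[of Basis b] up_def)
  qed
  have c': "c' (up \<alpha>) = c \<alpha>" for \<alpha>
    by (simp add: c'_def up_def)
  have up_in: "up \<alpha> \<in> ?P" if "\<alpha> \<in> ?P" for \<alpha>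
    using assms(1) that by (auto simp: up_def PiE_def extensional_def)
  have "((\<lambda>\<alpha>. (v \<bullet> b) * (c \<alpha> * ?m \<alpha>)) has_sum ((v \<bullet> b) * s)) ?P"
    by (rule has_sum_cmult_right[OF assms(2)])
  also have "(\<lambda>\<alpha>. (v \<bullet> b) * (c \<alpha> * ?m \<alpha>)) = (\<lambda>\<alpha>. c' \<alpha> * ?m \<alpha>) \<circ> up"
    by (rule ext) (simp only: o_def c' m mult.left_commute)
  also have "(\<dots> has_sum ((v \<bullet> b) * s)) ?P \<longleftrightarrow> ((\<lambda>\<alpha>. c' \<alpha> * ?m \<alpha>) has_sum ((v \<bullet> b) * s)) (up ` ?P)"
    by (rule has_sum_reindex[OF inj, symmetric])
  also have "\<dots> \<longleftrightarrow> ((\<lambda>\<alpha>. c' \<alpha> * ?m \<alpha>) has_sum ((v \<bullet> b) * s)) ?P"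
  proof (rule has_sum_cong_neutral)
    fix \<alpha> assume \<alpha>: "\<alpha> \<in> ?P - up ` ?P"
    show "c' \<alpha> * ?m \<alpha> = 0"
    proof (cases "\<alpha> b = 0")
      case False
      then have "\<alpha> = up (\<alpha>(b := \<alpha> b - 1))" by (auto simp: up_def)
      moreover have "\<alpha>(b := \<alpha> b - 1) \<in> ?P"
        using \<alpha> assms(1) by (auto simp: PiE_def extensional_def)
      ultimately show ?thesis using \<alpha> by blast
    qed (simp add: c'_def)
  next
    fix \<alpha> assume "\<alpha> \<in> up ` ?P - ?P"
    then show "c' \<alpha> * ?m \<alpha> = 0"
      using up_in by blast
  qed simp
  finally show ?thesis
    by (simp add: c'_def)
qed

text \<open>The coordinate of q is that of p plus that of q - p: the first summand scales the
  series, the second shifts it. The vector field is built from functions of one variable by such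
  products, sums and constant factors, so the Cauchy product of two general series is
  avoided.\<close>

lemma real_analytic_on_mult_coord:
  fixes b :: "'a::euclidean_space"
  assumes "f real_analytic_on S" "b \<in> Basis"
  shows "(\<lambda>q. (q \<bullet> b) * f q) real_analytic_on S"
  unfolding real_analytic_on_iff
proof
  fix p assume "p \<in> S"
  then obtain r c where r: "r > 0" and c: "power_series_on_ball f p r c"
    using assms unfolding real_analytic_on_iff by blast
  define c' where "c' \<alpha> = (p \<bullet> b) * c \<alpha> + (if \<alpha> b = 0 then 0 else c (\<alpha>(b := \<alpha> b - 1)))" for \<alpha>
  have "power_series_on_ball (\<lambda>q. (q \<bullet> b) * f q) p r c'"
  proof (rule power_series_on_ballI)
    fix q assume q: "q \<in> ball p r"
    have eq: "(q \<bullet> b) * f q = (p \<bullet> b) * f q + ((q - p) \<bullet> b) * f q"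
      by (simp add: algebra_simps)
    show "((\<lambda>\<alpha>. c' \<alpha> * (\<Prod>b\<in>Basis. ((q - p) \<bullet> b) ^ \<alpha> b)) has_sum ((q \<bullet> b) * f q))
        (Basis \<rightarrow>\<^sub>E UNIV)"
      unfolding eq c'_def distrib_right mult.assoc
      by (intro has_sum_add has_sum_cmult_right has_sum_monomial_shift assms(2)
          power_series_on_ballD[OF c q])
  qed
  with r show "\<exists>r>0. \<exists>c. power_series_on_ball (\<lambda>q. (q \<bullet> b) * f q) p r c"
    by blast
qed

section \<open>Termwise differentiation of power series\<close>

lemma has_sum_powser_deriv:
  fixes d :: "nat \<Rightarrow> real"
  assumes "\<And>t. \<bar>t\<bar> < r \<Longrightarrow> ((\<lambda>n. d n * t ^ n) has_sum h t) UNIV" "\<bar>t\<bar> < r"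
  shows "(h has_real_derivative deriv h t) (at t)"
    and "((\<lambda>n. diffs d n * t ^ n) has_sum deriv h t) UNIV"
proof -
  have sums: "(\<lambda>n. d n * u ^ n) sums h u" if "\<bar>u\<bar> < r" for u
    by (rule has_sum_imp_sums[OF assms(1)[OF that]])
  \<comment> \<open>Convergence at a point strictly between |t| and r yields differentiability and
    absolute convergence at t; the latter turns \<open>sums\<close> into
    \<open>has_sum\<close>.\<close>
  obtain K where K: "\<bar>t\<bar> < K" "K < r"
    using dense[OF assms(2)] by blast
  then obtain L where L: "K < L" "L < r"
    using dense by blast
  have diffs: "summable (\<lambda>n. diffs d n * u ^ n)" if "\<bar>u\<bar> < r" for u
    using termdiff_converges[of u r d] sums that by (auto simp: summable_def)
  have D0: "((\<lambda>u. \<Sum>n. d n * u ^ n) has_real_derivative (\<Sum>n. diffs d n * t ^ n)) (at t)"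
    using K sums[of K] by (intro termdiffs_strong[of d K]) (auto simp: summable_def)
  \<comment> \<open>The series represents \<open>h\<close> only for |u| < r, so the derivative is
    transferred by equality near t.\<close>
  have ev: "\<forall>\<^sub>F u in nhds t. (\<Sum>n. d n * u ^ n) = h u"
  proof -
    have "\<forall>\<^sub>F u in nhds t. u \<in> {-r<..<r}"
      using assms(2) by (intro eventually_nhds_in_open) auto
    then show ?thesis
      by eventually_elim (use sums in \<open>auto simp: sums_iff\<close>)
  qed
  have D: "(h has_real_derivative (\<Sum>n. diffs d n * t ^ n)) (at t)"
    by (rule DERIV_cong_ev[THEN iffD1, OF refl ev refl D0])
  then show "(h has_real_derivative deriv h t) (at t)"
    by (simp add: DERIV_imp_deriv)
  have "summable (\<lambda>n. norm (diffs d n * t ^ n))"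
    using powser_insidea[OF diffs[of K], of t] K by auto
  then show "((\<lambda>n. diffs d n * t ^ n) has_sum deriv h t) UNIV"
    using diffs[OF assms(2)] DERIV_imp_deriv[OF D]
    by (intro norm_summable_imp_has_sum) (auto simp: summable_sums)
qed

lemma real_analytic_on_line_differentiable:
  fixes f :: "'a::euclidean_space \<Rightarrow> real"
  assumes "f real_analytic_on S" "p \<in> S" "b \<in> Basis"
  shows "(\<lambda>t. f (p + t *\<^sub>R b)) field_differentiable at 0"
proof -
  obtain r d where r: "r > 0" and d: "\<forall>t. \<bar>t\<bar> < r \<longrightarrow>
      ((\<lambda>n. d n * t ^ n) has_sum f (p + t *\<^sub>R b)) (UNIV :: nat set)"
    using real_analytic_on_line[OF assms] by (elim exE conjE)
  from has_sum_powser_deriv(1)[OF d[rule_format], where t = 0] r show ?thesis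
    unfolding field_differentiable_def by auto
qed

lemma real_analytic_on_deriv:
  fixes h :: "real \<Rightarrow> real"
  assumes "h real_analytic_on I"
  shows "deriv h real_analytic_on I"
    and "x \<in> I \<Longrightarrow> (h has_real_derivative deriv h x) (at x)"
proof -
  have key: "\<exists>r>0. \<exists>d. \<forall>t. \<bar>t\<bar> < r \<longrightarrow> ((\<lambda>n. d n * t ^ n) has_sum deriv h (p + t)) (UNIV :: nat set) \<and>
      (h has_real_derivative deriv h (p + t)) (at (p + t))" if p: "p \<in> I" for p
  proof -
    obtain r d where r: "r > 0" and "\<forall>t. \<bar>t\<bar> < r \<longrightarrow>
        ((\<lambda>n. d n * t ^ n) has_sum h (p + t *\<^sub>R 1)) (UNIV :: nat set)"
      using real_analytic_on_line[OF assms p, of 1] by auto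
    then have d: "\<And>t. \<bar>t\<bar> < r \<Longrightarrow> ((\<lambda>n. d n * t ^ n) has_sum h (p + t)) (UNIV :: nat set)"
      by simp
    have "((\<lambda>n. diffs d n * t ^ n) has_sum deriv h (p + t)) UNIV \<and>
        (h has_real_derivative deriv h (p + t)) (at (p + t))" if t: "\<bar>t\<bar> < r" for t
    proof -
      \<comment> \<open>The expansion is centred at p; the result at t is translated to p +
        t.\<close>
      have D: "(h has_real_derivative deriv (\<lambda>t. h (p + t)) t) (at (p + t))"
        using has_sum_powser_deriv(1)[OF d t]
        unfolding add.commute[of p] by (rule DERIV_shift[THEN iffD2])
      then show ?thesis
        using has_sum_powser_deriv(2)[OF d t] DERIV_imp_deriv[OF D] by simp
    qed
    with r show ?thesis
      by (intro exI[of _ r] conjI exI[of _ "diffs d"] allI impI) simp_all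
  qed
  have "(\<lambda>q. deriv h (q \<bullet> 1)) real_analytic_on I"
  proof (rule real_analytic_on_coordI)
    fix p assume "p \<in> I"
    from key[OF this] show "\<exists>r>0. \<exists>d. \<forall>t. \<bar>t\<bar> < r \<longrightarrow>
        ((\<lambda>n. d n * t ^ n) has_sum deriv h (p \<bullet> 1 + t)) (UNIV :: nat set)"
      unfolding inner_real_def mult_1_right by meson
  qed simp
  then show "deriv h real_analytic_on I"
    by simp
  show "(h has_real_derivative deriv h x) (at x)" if "x \<in> I"
    using key[OF that] by (metis abs_zero add.right_neutral)
qed

subsection \<open>Partial and total derivatives on jet space\<close>

text \<open>Kronecker deltas written with \<open>of_bool\<close> let one formula cover all fourteen
  jet coordinates.\<close>

lemma deriv_fun_upd:
  "((\<lambda>t. ((J :: jet)(c := t)) d) has_real_derivative of_bool (c = d)) (at x)"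
  by (cases "c = d") auto

text \<open>The direction in which \<open>base J\<close> moves when the coordinate \<open>c\<close>
  varies; it is 0 for derivative coordinates.\<close>

definition coord_axis :: "jet_coord \<Rightarrow> base_point" where
  "coord_axis c = (of_bool (c = jx), of_bool (c = jy), of_bool (c = jw), of_bool (c = jE))"

lemma base_fun_upd: "base (J(c := t)) = base J + (t - J c) *\<^sub>R coord_axis c"
  by (cases c) (auto simp: base_def coord_axis_def)

lemma coord_axis_in_Basis: "c \<in> {jx, jy, jw, jE} \<Longrightarrow> coord_axis c \<in> Basis"
  by (auto simp: coord_axis_def Basis_prod_def zero_prod_def)

lemma coord_axis_eq_0: "c \<notin> {jx, jy, jw, jE} \<Longrightarrow> coord_axis c = 0"
  by (auto simp: coord_axis_def zero_prod_def)

text \<open>Varying x, y, w or E moves the base point along a coordinate line, where analyticity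
  gives differentiability; varying any other coordinate leaves it fixed.\<close>

lemma has_derivative_partial_base:
  assumes "f real_analytic_on \<Omega>" "base J \<in> \<Omega>"
  shows "((\<lambda>t. f (base (J(c := t)))) has_real_derivative partial c (f \<circ> base) J) (at (J c))"
proof (cases "c \<in> {jx, jy, jw, jE}")
  case True
  \<comment> \<open>The point 0 is written as \<open>J c + - J c\<close> to fit
    \<open>DERIV_shift\<close>.\<close>
  have "(\<lambda>t. f (base J + t *\<^sub>R coord_axis c)) field_differentiable at (J c + - J c)"
    using real_analytic_on_line_differentiable[OF assms coord_axis_in_Basis[OF True]] by simp
  then have "(\<lambda>t. f (base (J(c := t)))) field_differentiable at (J c)"
    unfolding field_differentiable_def DERIV_shift base_fun_upd by simp
  then show ?thesis
    unfolding partial_def o_def by (simp add: DERIV_deriv_iff_field_differentiable)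
next
  case False
  then show ?thesis
    by (simp add: partial_def o_def base_fun_upd coord_axis_eq_0)
qed

lemma partial_eqI: "((\<lambda>t. f (J(c := t))) has_real_derivative D) (at (J c)) \<Longrightarrow> partial c f J = D"
  unfolding partial_def by (rule DERIV_imp_deriv)

lemma partial_base_eq_0: "c \<notin> {jx, jy, jw, jE} \<Longrightarrow> partial c (f \<circ> base) J = 0"
  by (simp add: partial_def base_fun_upd coord_axis_eq_0)

lemma total_dx_base:
  "total_dx (f \<circ> base) J = partial jx (f \<circ> base) J + J jwx * partial jw (f \<circ> base) J
     + J jEx * partial jE (f \<circ> base) J"
  by (simp add: total_dx_def partial_base_eq_0)

lemma total_dy_base:
  "total_dy (f \<circ> base) J = partial jy (f \<circ> base) J + J jwy * partial jw (f \<circ> base) J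
     + J jEy * partial jE (f \<circ> base) J"
  by (simp add: total_dy_def partial_base_eq_0)

text \<open>Coefficients are prescribed on \<Omega> only. As \<Omega> is open, agreement over
  \<Omega> is agreement near \<open>J c\<close> along each coordinate line, hence equality of
  derivatives.\<close>

lemma partial_cong:
  assumes "open \<Omega>" "base J \<in> \<Omega>" "\<And>K. base K \<in> \<Omega> \<Longrightarrow> f K = g K"
  shows "partial c f J = partial c g J"
proof -
  have "open ((\<lambda>t. base (J(c := t))) -` \<Omega>)"
    unfolding base_fun_upd by (intro continuous_open_vimage assms continuous_intros)
  then have "\<forall>\<^sub>F t in nhds (J c). t \<in> (\<lambda>t. base (J(c := t))) -` \<Omega>"
    using assms(2) by (intro eventually_nhds_in_open) auto
  then have "\<forall>\<^sub>F t in nhds (J c). f (J(c := t)) = g (J(c := t))"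
    by eventually_elim (simp add: assms(3))
  then show ?thesis
    unfolding partial_def by (intro deriv_cong_ev refl)
qed

lemma partial_surf_w:
  assumes "\<xi> real_analytic_on \<Omega>" "\<phi> real_analytic_on \<Omega>" "base J \<in> \<Omega>"
  shows "partial c (surf_w \<xi> \<phi>) J = partial c (\<xi> \<circ> base) J * J jwx
    + \<xi> (base J) * of_bool (c = jwx) + of_bool (c = jwy) - partial c (\<phi> \<circ> base) J"
  unfolding surf_w_def[abs_def]
  by (rule partial_eqI)
    (auto intro!: derivative_eq_intros deriv_fun_upd has_derivative_partial_base assms)

lemma partial_surf_E:
  assumes "\<xi> real_analytic_on \<Omega>" "\<psi> real_analytic_on \<Omega>" "base J \<in> \<Omega>"
  shows "partial c (surf_E \<xi> \<psi>) J = partial c (\<xi> \<circ> base) J * J jEx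
    + \<xi> (base J) * of_bool (c = jEx) + of_bool (c = jEy) - partial c (\<psi> \<circ> base) J"
  unfolding surf_E_def[abs_def]
  by (rule partial_eqI)
    (auto intro!: derivative_eq_intros deriv_fun_upd has_derivative_partial_base assms)

lemma partial_pde:
  "partial c pde J = of_bool (c = jwx) * J jEx + of_bool (c = jEx) * J jwx
     + of_bool (c = jwy) * J jEy + of_bool (c = jEy) * J jwy
     + of_bool (c = jE) * (J jwxx + J jwyy) + (of_bool (c = jwxx) + of_bool (c = jwyy)) * J jE"
  unfolding pde_def[abs_def]
  by (rule partial_eqI) (auto intro!: derivative_eq_intros deriv_fun_upd)

subsection \<open>The determining equations\<close>

lemma total_const: "total_dx (\<lambda>_. a) J = 0" "total_dy (\<lambda>_. a) J = 0"
  by (simp_all add: total_dx_def total_dy_def partial_def)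

lemma const_comp_base: "(\<lambda>_. a) \<circ> base = (\<lambda>_. a)"
  by (simp add: o_def)

text \<open>Leaves \<psi> open, so that it can be interpreted both for the claimed field and for an
  arbitrary generator with the same \<xi> and \<phi> on \<Omega>.\<close>

locale nonclassical_ansatz =
  fixes k :: real and \<mu> :: "real \<Rightarrow> real" and I :: "real set" and \<Omega> :: "base_point set"
    and \<xi> \<phi> \<psi> :: "base_point \<Rightarrow> real"
  assumes open_\<Omega>: "open \<Omega>"
    and \<mu>_analytic: "\<mu> real_analytic_on I"
    and \<Omega>_subset: "(x, y, w, E) \<in> \<Omega> \<Longrightarrow> w \<in> I \<and> E \<noteq> 0"
    and analytic: "\<xi> real_analytic_on \<Omega>" "\<phi> real_analytic_on \<Omega>" "\<psi> real_analytic_on \<Omega>"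
    and \<xi>_eq: "(x, y, w, E) \<in> \<Omega> \<Longrightarrow> \<xi> (x, y, w, E) = k"
    and \<phi>_eq: "(x, y, w, E) \<in> \<Omega> \<Longrightarrow> \<phi> (x, y, w, E) = (k\<^sup>2 + 1) * (k * x + y) * \<mu> w"
begin

text \<open>The coefficients of the first prolongation at \<open>jwx\<close> and \<open>jwy\<close>,
  for \<open>D\<close> equal to \<open>total_dx\<close> and \<open>total_dy\<close>; the constant 1
  is the normalized coefficient of the y-direction.\<close>

definition prolonged_w :: "((jet \<Rightarrow> real) \<Rightarrow> jet \<Rightarrow> real) \<Rightarrow> jet \<Rightarrow> real" where
  "prolonged_w D = prolong_coeff D (\<xi> \<circ> base) (\<lambda>_. 1) (\<phi> \<circ> base) jwx jwy"

lemma \<xi>_base: "base J \<in> \<Omega> \<Longrightarrow> \<xi> (base J) = k"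
  unfolding base_def by (rule \<xi>_eq)

lemma \<phi>_base: "base J \<in> \<Omega> \<Longrightarrow> \<phi> (base J) = (k\<^sup>2 + 1) * (k * J jx + J jy) * \<mu> (J jw)"
  unfolding base_def by (rule \<phi>_eq)

lemma has_derivative_\<mu>_upd:
  assumes "base J \<in> \<Omega>"
  shows "((\<lambda>t. \<mu> ((J(c := t)) jw)) has_real_derivative deriv \<mu> (J jw) * of_bool (c = jw)) (at (J c))"
    and "((\<lambda>t. deriv \<mu> ((J(c := t)) jw)) has_real_derivative deriv (deriv \<mu>) (J jw) * of_bool (c = jw)) (at (J c))"
proof -
  have w: "J jw \<in> I"
    using \<Omega>_subset assms unfolding base_def by blast
  show "((\<lambda>t. \<mu> ((J(c := t)) jw)) has_real_derivative deriv \<mu> (J jw) * of_bool (c = jw)) (at (J c))"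
    using real_analytic_on_deriv(2)[OF \<mu>_analytic w] by (cases "c = jw") auto
  show "((\<lambda>t. deriv \<mu> ((J(c := t)) jw)) has_real_derivative deriv (deriv \<mu>) (J jw) * of_bool (c = jw)) (at (J c))"
    using real_analytic_on_deriv(2)[OF real_analytic_on_deriv(1)[OF \<mu>_analytic] w]
    by (cases "c = jw") auto
qed

lemma partial_\<xi>:
  assumes "base J \<in> \<Omega>"
  shows "partial c (\<xi> \<circ> base) J = 0"
proof -
  have "partial c (\<xi> \<circ> base) J = partial c (\<lambda>_. k) J"
    by (rule partial_cong[OF open_\<Omega> assms]) (simp add: \<xi>_base)
  then show ?thesis
    by (simp add: partial_def)
qed

lemma partial_\<phi>:
  assumes "base J \<in> \<Omega>"
  shows "partial c (\<phi> \<circ> base) J = (k\<^sup>2 + 1) * ((k * of_bool (c = jx) + of_bool (c = jy)) * \<mu> (J jw)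
    + (k * J jx + J jy) * deriv \<mu> (J jw) * of_bool (c = jw))"
proof -
  have "partial c (\<phi> \<circ> base) J = partial c (\<lambda>J. (k\<^sup>2 + 1) * (k * J jx + J jy) * \<mu> (J jw)) J"
    by (rule partial_cong[OF open_\<Omega> assms]) (simp add: \<phi>_base)
  also have "\<dots> = (k\<^sup>2 + 1) * ((k * of_bool (c = jx) + of_bool (c = jy)) * \<mu> (J jw)
    + (k * J jx + J jy) * deriv \<mu> (J jw) * of_bool (c = jw))"
    by (rule partial_eqI)
      (rule derivative_eq_intros deriv_fun_upd has_derivative_\<mu>_upd assms refl | simp add: algebra_simps)+
  finally show ?thesis .
qed

lemma prolonged_w_first:
  assumes "base J \<in> \<Omega>"
  shows "prolonged_w total_dx J =
      (k\<^sup>2 + 1) * (k * \<mu> (J jw) + (k * J jx + J jy) * deriv \<mu> (J jw) * J jwx)"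
    and "prolonged_w total_dy J =
      (k\<^sup>2 + 1) * (\<mu> (J jw) + (k * J jx + J jy) * deriv \<mu> (J jw) * J jwy)"
  unfolding prolonged_w_def prolong_coeff_def total_dx_base total_dy_base
    partial_\<xi>[OF assms] partial_\<phi>[OF assms]
  by (simp_all add: total_const partial_def algebra_simps)

text \<open>The formulas of \<open>prolonged_w_first\<close> hold at all jets over \<Omega>, not
  only on the invariant surfaces, so they may be differentiated again.\<close>

lemma partial_prolonged_w:
  assumes "base J \<in> \<Omega>"
  shows "partial c (prolonged_w total_dx) J = (k\<^sup>2 + 1) * (k * deriv \<mu> (J jw) * of_bool (c = jw)
      + (k * of_bool (c = jx) + of_bool (c = jy)) * deriv \<mu> (J jw) * J jwx
      + (k * J jx + J jy) * deriv (deriv \<mu>) (J jw) * of_bool (c = jw) * J jwx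
      + (k * J jx + J jy) * deriv \<mu> (J jw) * of_bool (c = jwx))" (is "?L1 = ?R1")
    and "partial c (prolonged_w total_dy) J = (k\<^sup>2 + 1) * (deriv \<mu> (J jw) * of_bool (c = jw)
      + (k * of_bool (c = jx) + of_bool (c = jy)) * deriv \<mu> (J jw) * J jwy
      + (k * J jx + J jy) * deriv (deriv \<mu>) (J jw) * of_bool (c = jw) * J jwy
      + (k * J jx + J jy) * deriv \<mu> (J jw) * of_bool (c = jwy))" (is "?L2 = ?R2")
proof -
  have "?L1 = partial c (\<lambda>J. (k\<^sup>2 + 1) * (k * \<mu> (J jw) + (k * J jx + J jy) * deriv \<mu> (J jw) * J jwx)) J"
    by (rule partial_cong[OF open_\<Omega> assms prolonged_w_first(1)])
  also have "\<dots> = ?R1"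
    by (rule partial_eqI)
      (rule derivative_eq_intros deriv_fun_upd has_derivative_\<mu>_upd assms refl | simp add: algebra_simps)+
  finally show "?L1 = ?R1" .
  have "?L2 = partial c (\<lambda>J. (k\<^sup>2 + 1) * (\<mu> (J jw) + (k * J jx + J jy) * deriv \<mu> (J jw) * J jwy)) J"
    by (rule partial_cong[OF open_\<Omega> assms prolonged_w_first(2)])
  also have "\<dots> = ?R2"
    by (rule partial_eqI)
      (rule derivative_eq_intros deriv_fun_upd has_derivative_\<mu>_upd assms refl | simp add: algebra_simps)+
  finally show "?L2 = ?R2" .
qed

section \<open>Prolongation formulas for constant \<xi>\<close>

lemma total_\<xi>:
  assumes "base J \<in> \<Omega>"
  shows "total_dx (\<xi> \<circ> base) J = 0" "total_dy (\<xi> \<circ> base) J = 0"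
  by (simp_all add: total_dx_base total_dy_base partial_\<xi>[OF assms])

lemma prolong_coeff_eq:
  assumes "base J \<in> \<Omega>"
  shows "prolong_coeff total_dx (\<xi> \<circ> base) (\<lambda>_. 1) \<zeta> u v J = total_dx \<zeta> J"
    "prolong_coeff total_dy (\<xi> \<circ> base) (\<lambda>_. 1) \<zeta> u v J = total_dy \<zeta> J"
  by (simp_all add: prolong_coeff_def total_\<xi>[OF assms] total_const)

text \<open>The equation contains neither the mixed derivative of w nor second derivatives of E, so
  among the second-order coefficients only those at \<open>jwxx\<close> and \<open>jwyy\<close>
  enter.\<close>

lemma pr2_pde:
  assumes "base J \<in> \<Omega>"
  shows "pr2 \<xi> (\<lambda>_. 1) \<phi> \<psi> pde J =
      prolonged_w total_dx J * J jEx + prolonged_w total_dy J * J jEy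
      + total_dx (\<psi> \<circ> base) J * J jwx + total_dy (\<psi> \<circ> base) J * J jwy
      + \<psi> (base J) * (J jwxx + J jwyy)
      + J jE * (total_dx (prolonged_w total_dx) J + total_dy (prolonged_w total_dy) J)"
  unfolding pr2_def pr1_def Let_def const_comp_base prolonged_w_def[symmetric]
  by (simp add: prolong_coeff_eq[OF assms] partial_pde algebra_simps)

text \<open>In this form the differentiated surface equations can be solved for \<open>jwxy\<close>,
  \<open>jwyy\<close>, \<open>jExy\<close> and \<open>jEyy\<close>.\<close>

lemma total_surf:
  assumes "base J \<in> \<Omega>"
  shows "total_dx (surf_w \<xi> \<phi>) J = k * J jwxx + J jwxy - prolonged_w total_dx J"
    and "total_dy (surf_w \<xi> \<phi>) J = k * J jwxy + J jwyy - prolonged_w total_dy J"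
    and "total_dx (surf_E \<xi> \<psi>) J = k * J jExx + J jExy - total_dx (\<psi> \<circ> base) J"
    and "total_dy (surf_E \<xi> \<psi>) J = k * J jExy + J jEyy - total_dy (\<psi> \<circ> base) J"
  unfolding total_dx_def[of "surf_w \<xi> \<phi>"] total_dy_def[of "surf_w \<xi> \<phi>"]
    total_dx_def[of "surf_E \<xi> \<psi>"] total_dy_def[of "surf_E \<xi> \<psi>"]
    partial_surf_w[OF analytic(1,2) assms] partial_surf_E[OF analytic(1,3) assms]
  by (simp_all add: partial_\<xi>[OF assms] \<xi>_base[OF assms] prolonged_w_def prolong_coeff_eq[OF assms]
      total_dx_base total_dy_base partial_base_eq_0 algebra_simps)

text \<open>For constant \<xi> the prolonged field maps the surface function to k D_x \<phi> + D_y
  \<phi> minus the field applied to \<phi>. On the surfaces k w_x + w_y = \<phi> and k E_x + E_y =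
  \<psi>, so the two agree; likewise for \<psi>.\<close>

lemma pr1_surf:
  assumes "base J \<in> \<Omega>" "surf_w \<xi> \<phi> J = 0" "surf_E \<xi> \<psi> J = 0"
  shows "pr1 \<xi> (\<lambda>_. 1) \<phi> \<psi> (surf_w \<xi> \<phi>) J = 0"
    and "pr1 \<xi> (\<lambda>_. 1) \<phi> \<psi> (surf_E \<xi> \<psi>) J = 0"
proof -
  have s: "J jwy = \<phi> (base J) - k * J jwx" "J jEy = \<psi> (base J) - k * J jEx"
    using assms by (simp_all add: surf_w_def surf_E_def \<xi>_base)
  show "pr1 \<xi> (\<lambda>_. 1) \<phi> \<psi> (surf_w \<xi> \<phi>) J = 0" "pr1 \<xi> (\<lambda>_. 1) \<phi> \<psi> (surf_E \<xi> \<psi>) J = 0"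
    unfolding pr1_def Let_def const_comp_base prolong_coeff_eq[OF assms(1)]
      partial_surf_w[OF analytic(1,2) assms(1)] partial_surf_E[OF analytic(1,3) assms(1)]
    by (simp_all add: \<xi>_base[OF assms(1)] partial_\<xi>[OF assms(1)] total_dx_base total_dy_base
        partial_base_eq_0 s algebra_simps)
qed

section \<open>The invariance condition: sufficiency and necessity\<close>

lemma total_prolonged_w:
  assumes "base J \<in> \<Omega>"
  shows "total_dx (prolonged_w total_dx) J = (k\<^sup>2 + 1) * (2 * k * deriv \<mu> (J jw) * J jwx
      + (k * J jx + J jy) * (deriv (deriv \<mu>) (J jw) * (J jwx)\<^sup>2 + deriv \<mu> (J jw) * J jwxx))"
    and "total_dy (prolonged_w total_dy) J = (k\<^sup>2 + 1) * (2 * deriv \<mu> (J jw) * J jwy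
      + (k * J jx + J jy) * (deriv (deriv \<mu>) (J jw) * (J jwy)\<^sup>2 + deriv \<mu> (J jw) * J jwyy))"
  unfolding total_dx_def[of "prolonged_w total_dx"] total_dy_def[of "prolonged_w total_dy"]
    partial_prolonged_w[OF assms]
  by (simp_all add: algebra_simps power2_eq_square)

text \<open>With this \<psi> the terms in w_xx + w_yy, in \<mu>'' and in P = w_x E_x + w_y E_y
  cancel. There remains c (\<mu> (k E_x + E_y) + E \<mu>' (k w_x + w_y)), with c = k^2 + 1, which on
  the surfaces is c (\<mu> \<psi> + E \<mu>' \<phi>) = 0.\<close>

lemma pr2_pde_eq_0:
  assumes J: "base J \<in> \<Omega>" "surf_w \<xi> \<phi> J = 0" "surf_E \<xi> \<psi> J = 0"
    and \<psi>: "\<And>x y w E. (x, y, w, E) \<in> \<Omega> \<Longrightarrow>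
      \<psi> (x, y, w, E) = - (k\<^sup>2 + 1) * (k * x + y) * deriv \<mu> w * E"
  shows "pr2 \<xi> (\<lambda>_. 1) \<phi> \<psi> pde J = 0"
proof -
  have \<psi>_base: "\<psi> (base K) = - (k\<^sup>2 + 1) * (k * K jx + K jy) * deriv \<mu> (K jw) * K jE"
    if "base K \<in> \<Omega>" for K
    using that unfolding base_def by (rule \<psi>)
  have partial_\<psi>: "partial c (\<psi> \<circ> base) J = - (k\<^sup>2 + 1) *
      ((k * of_bool (c = jx) + of_bool (c = jy)) * deriv \<mu> (J jw) * J jE
       + (k * J jx + J jy) * deriv (deriv \<mu>) (J jw) * of_bool (c = jw) * J jE
       + (k * J jx + J jy) * deriv \<mu> (J jw) * of_bool (c = jE))" (is "_ = ?R") for c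
  proof -
    have "partial c (\<psi> \<circ> base) J =
        partial c (\<lambda>K. - (k\<^sup>2 + 1) * (k * K jx + K jy) * deriv \<mu> (K jw) * K jE) J"
      by (rule partial_cong[OF open_\<Omega> J(1)]) (simp only: o_def \<psi>_base)
    also have "\<dots> = ?R"
      by (rule partial_eqI)
        (rule derivative_eq_intros deriv_fun_upd has_derivative_\<mu>_upd J(1) refl | simp add: algebra_simps)+
    finally show ?thesis .
  qed
  have s: "J jwy = (k\<^sup>2 + 1) * (k * J jx + J jy) * \<mu> (J jw) - k * J jwx"
    "J jEy = - (k\<^sup>2 + 1) * (k * J jx + J jy) * deriv \<mu> (J jw) * J jE - k * J jEx"
    using J \<psi>_base[OF J(1)] by (simp_all add: surf_w_def surf_E_def \<xi>_base \<phi>_base)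
  show ?thesis
    unfolding pr2_pde[OF J(1)] prolonged_w_first[OF J(1)] total_prolonged_w[OF J(1)]
      total_dx_base total_dy_base partial_\<psi> \<psi>_base[OF J(1)] s
    by simp algebra
qed

text \<open>The free values \<open>a\<close> of w_x and \<open>b\<close> of E_x are completed to a
  jet satisfying all side conditions, and the invariance condition is evaluated there.
  \<open>P\<close> and \<open>N\<close> become w_x E_x + w_y E_y and the sum of the squares of w_x
  and w_y.\<close>

lemma determining_equation:
  assumes p: "(x, y, w, E) \<in> \<Omega>"
    and gen: "nonclassical_generator \<Omega> \<xi> \<phi> \<psi>"
  fixes a b :: real
  defines "f \<equiv> (k\<^sup>2 + 1) * (k * x + y) * \<mu> w" and "g \<equiv> \<psi> (x, y, w, E)"
  defines "gx \<equiv> deriv (\<lambda>t. \<psi> (t, y, w, E)) x" and "gy \<equiv> deriv (\<lambda>t. \<psi> (x, t, w, E)) y"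
    and "gw \<equiv> deriv (\<lambda>t. \<psi> (x, y, t, E)) w" and "gE \<equiv> deriv (\<lambda>t. \<psi> (x, y, w, t)) E"
    and "P \<equiv> a * b + (f - k * a) * (g - k * b)" and "N \<equiv> a\<^sup>2 + (f - k * a)\<^sup>2"
  shows "(k\<^sup>2 + 1) * \<mu> w * g + a * gx + (f - k * a) * gy
    + (gw + E * (k\<^sup>2 + 1) * (k * x + y) * deriv (deriv \<mu>) w) * N + gE * P - g / E * (1 + P)
    + 2 * (k\<^sup>2 + 1) * E * deriv \<mu> w * f - (k\<^sup>2 + 1) * (k * x + y) * deriv \<mu> w = 0"
proof -
  have E: "E \<noteq> 0" and c: "k\<^sup>2 + 1 \<noteq> 0"
    using \<Omega>_subset[OF p] by (auto simp: add_nonneg_eq_0_iff)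
  define m1 where "m1 = deriv \<mu> w"
  \<comment> \<open>\<open>fx\<close>, \<open>fy\<close> will be the prolonged coefficients of w at
    the jet below, and \<open>Gx\<close>, \<open>Gy\<close> the total derivatives of \<psi>.\<close>
  define fx where "fx = (k\<^sup>2 + 1) * (k * \<mu> w + (k * x + y) * m1 * a)"
  define fy where "fy = (k\<^sup>2 + 1) * (\<mu> w + (k * x + y) * m1 * (f - k * a))"
  define Gx where "Gx = gx + a * gw + b * gE"
  define Gy where "Gy = gy + (f - k * a) * gw + (g - k * b) * gE"
  \<comment> \<open>the value of \<open>w\<^sub>x\<^sub>x\<close> that solves the PDE on the invariant surfaces\<close>
  define r where "r = ((- 1 - P) / E - fy + k * fx) / (k\<^sup>2 + 1)"
  \<comment> \<open>The surface equations and their total derivatives dictate all entries except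
    \<open>jwxx\<close>, which the PDE fixes, and \<open>jExx\<close>, which is free and set to
    0.\<close>
  define J where "J = (\<lambda>c. case c of jx \<Rightarrow> x | jy \<Rightarrow> y | jw \<Rightarrow> w | jE \<Rightarrow> E
    | jwx \<Rightarrow> a | jwy \<Rightarrow> f - k * a | jEx \<Rightarrow> b | jEy \<Rightarrow> g - k * b
    | jwxx \<Rightarrow> r | jwxy \<Rightarrow> fx - k * r | jwyy \<Rightarrow> fy - k * (fx - k * r)
    | jExx \<Rightarrow> 0 | jExy \<Rightarrow> Gx | jEyy \<Rightarrow> Gy - k * Gx)"
  have J: "J jx = x" "J jy = y" "J jw = w" "J jE = E" "J jwx = a" "J jwy = f - k * a"
    "J jEx = b" "J jEy = g - k * b" "J jwxx = r" "J jwxy = fx - k * r"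
    "J jwyy = fy - k * (fx - k * r)" "J jExx = 0" "J jExy = Gx" "J jEyy = Gy - k * Gx"
    by (simp_all add: J_def)
  have base: "base J = (x, y, w, E)" and base_in: "base J \<in> \<Omega>"
    using p by (simp_all add: base_def J)
  have "(k\<^sup>2 + 1) * r = (- 1 - P) / E - fy + k * fx"
    using c by (simp add: r_def)
  then have lap: "J jwxx + J jwyy = (- 1 - P) / E"
    by (simp add: J algebra_simps power2_eq_square)
  have w1: "prolonged_w total_dx J = fx" "prolonged_w total_dy J = fy"
    by (simp_all add: prolonged_w_first[OF base_in] J fx_def fy_def m1_def)
  have \<psi>1: "total_dx (\<psi> \<circ> base) J = Gx" "total_dy (\<psi> \<circ> base) J = Gy"
    by (simp_all add: total_dx_base total_dy_base partial_def base_def J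
        Gx_def Gy_def gx_def gy_def gw_def gE_def)
  have "pde J = 0"
    using E by (simp add: pde_def lap) (simp add: J P_def)
  moreover have "surf_w \<xi> \<phi> J = 0" "surf_E \<xi> \<psi> J = 0"
    by (simp_all add: surf_w_def surf_E_def \<xi>_base[OF base_in] \<phi>_base[OF base_in])
      (simp_all add: base J f_def g_def)
  moreover have "total_dx (surf_w \<xi> \<phi>) J = 0" "total_dy (surf_w \<xi> \<phi>) J = 0"
    "total_dx (surf_E \<xi> \<psi>) J = 0" "total_dy (surf_E \<xi> \<psi>) J = 0"
    by (simp_all add: total_surf[OF base_in] w1 \<psi>1) (simp_all add: J)
  ultimately have "pr2 \<xi> (\<lambda>_. 1) \<phi> \<psi> pde J = 0"
    using gen base_in unfolding nonclassical_generator_def by blast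
  \<comment> \<open>The terms linear in w_x and w_y combine through k w_x + w_y = f. The Laplacian
    is kept together with the factor E, ready to be replaced by -1 - P.\<close>
  moreover have "J jE * (total_dx (prolonged_w total_dx) J + total_dy (prolonged_w total_dy) J) =
      E * (k\<^sup>2 + 1) * (2 * m1 * f + (k * x + y) * deriv (deriv \<mu>) w * N)
      + (k\<^sup>2 + 1) * (k * x + y) * m1 * (E * (J jwxx + J jwyy))"
    unfolding total_prolonged_w[OF base_in]
    by (simp add: J N_def m1_def[symmetric]) (simp add: algebra_simps power2_eq_square)
  moreover have "E * (J jwxx + J jwyy) = - 1 - P"
    using E by (simp add: lap)
  ultimately have eq: "fx * b + fy * (g - k * b) + Gx * a + Gy * (f - k * a) + g * ((- 1 - P) / E)
      + (E * (k\<^sup>2 + 1) * (2 * m1 * f + (k * x + y) * deriv (deriv \<mu>) w * N)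
      + (k\<^sup>2 + 1) * (k * x + y) * m1 * (- 1 - P)) = 0"
    unfolding pr2_pde[OF base_in] w1 \<psi>1 by (simp only: lap base J(1-8) g_def)
  \<comment> \<open>The part with P here cancels against the P in the factor -1 - P, leaving the
    term free of E at the end of the claim.\<close>
  have "fx * b + fy * (g - k * b) = (k\<^sup>2 + 1) * (\<mu> w * g + (k * x + y) * m1 * P)"
    by (simp add: fx_def fy_def P_def algebra_simps)
  moreover have "Gx * a + Gy * (f - k * a) = a * gx + (f - k * a) * gy + gw * N + gE * P"
    by (simp add: Gx_def Gy_def P_def N_def algebra_simps power2_eq_square)
  moreover have "g * ((- 1 - P) / E) = - (g / E * (1 + P))"
    using E by (simp add: field_simps)
  ultimately show ?thesis
    using eq unfolding m1_def[symmetric] by (simp add: algebra_simps)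
qed

text \<open>The identity is polynomial in the arbitrary reals a and b. Its ab-coefficient gives the
  first equation; the second is its constant term once the coefficient of N is known to
  vanish.\<close>

lemma determining_equations:
  assumes p: "(x, y, w, E) \<in> \<Omega>"
    and gen: "nonclassical_generator \<Omega> \<xi> \<phi> \<psi>"
  shows "deriv (\<lambda>t. \<psi> (x, y, w, t)) E = \<psi> (x, y, w, E) / E"
    and "(k\<^sup>2 + 1) * \<mu> w * \<psi> (x, y, w, E)
      + (k\<^sup>2 + 1) * (k * x + y) * \<mu> w * deriv (\<lambda>t. \<psi> (x, t, w, E)) y
      - \<psi> (x, y, w, E) / E + 2 * (k\<^sup>2 + 1)\<^sup>2 * (k * x + y) * \<mu> w * deriv \<mu> w * E
      - (k\<^sup>2 + 1) * (k * x + y) * deriv \<mu> w = 0"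
proof -
  note det = determining_equation[OF p gen]
  define f where "f = (k\<^sup>2 + 1) * (k * x + y) * \<mu> w"
  define g where "g = \<psi> (x, y, w, E)"
  define h where "h = g / E"
  define gx where "gx = deriv (\<lambda>t. \<psi> (t, y, w, E)) x"
  define gy where "gy = deriv (\<lambda>t. \<psi> (x, t, w, E)) y"
  define gE where "gE = deriv (\<lambda>t. \<psi> (x, y, w, t)) E"
  define M where "M = deriv (\<lambda>t. \<psi> (x, y, t, E)) w + E * (k\<^sup>2 + 1) * (k * x + y) * deriv (deriv \<mu>) w"
  define Z where "Z = (k\<^sup>2 + 1) * \<mu> w * g
    + 2 * (k\<^sup>2 + 1) * E * deriv \<mu> w * f - (k\<^sup>2 + 1) * (k * x + y) * deriv \<mu> w"
  have D: "Z + a * gx + (f - k * a) * gy + M * (a\<^sup>2 + (f - k * a)\<^sup>2)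
      + (gE - h) * (a * b + (f - k * a) * (g - k * b)) - h = 0" for a b
    using det[of a b]
    unfolding f_def[symmetric] g_def[symmetric] h_def[symmetric] gx_def[symmetric]
      gy_def[symmetric] gE_def[symmetric] M_def[symmetric]
    by (simp add: Z_def algebra_simps)
  have c: "k\<^sup>2 + 1 \<noteq> 0"
    by (auto simp: add_nonneg_eq_0_iff)
  \<comment> \<open>The mixed second difference of \<open>D\<close> over the unit square isolates
    the coefficient of ab.\<close>
  have "(k\<^sup>2 + 1) * (gE - h) = 0"
    using D[of 1 1] D[of 1 0] D[of 0 1] D[of 0 0]
    by (simp add: algebra_simps power2_eq_square)
  with c have gE: "gE = h" by simp
  then show "deriv (\<lambda>t. \<psi> (x, y, w, t)) E = \<psi> (x, y, w, E) / E"
    by (simp add: gE_def h_def g_def)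
  \<comment> \<open>The symmetric second difference in a at b = 0 isolates the coefficient of the
    square of a.\<close>
  have "(k\<^sup>2 + 1) * M = 0"
    using D[of 1 0] D[of "-1" 0] D[of 0 0] unfolding gE
    by (simp add: algebra_simps power2_eq_square)
  with c have "M = 0" by simp
  with D[of 0 0] gE have "Z + f * gy - h = 0"
    by simp
  then show "(k\<^sup>2 + 1) * \<mu> w * \<psi> (x, y, w, E)
      + (k\<^sup>2 + 1) * (k * x + y) * \<mu> w * deriv (\<lambda>t. \<psi> (x, t, w, E)) y
      - \<psi> (x, y, w, E) / E + 2 * (k\<^sup>2 + 1)\<^sup>2 * (k * x + y) * \<mu> w * deriv \<mu> w * E
      - (k\<^sup>2 + 1) * (k * x + y) * deriv \<mu> w = 0"
    unfolding Z_def h_def gy_def f_def g_def by (simp add: algebra_simps power2_eq_square)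
qed

text \<open>The first determining equation says that \<psi> / E has zero E-derivative, so it is
  constant on E-intervals. One d must serve all u near y, because the relation is later
  differentiated in y.\<close>

lemma linear_in_E:
  assumes p: "(x, y, w, E) \<in> \<Omega>"
    and gen: "nonclassical_generator \<Omega> \<xi> \<phi> \<psi>"
  shows "\<exists>d>0. \<forall>u v. \<bar>u - y\<bar> < d \<longrightarrow> \<bar>v - E\<bar> < d \<longrightarrow>
      (x, u, w, v) \<in> \<Omega> \<and> \<psi> (x, u, w, v) = \<psi> (x, u, w, E) / E * v"
proof -
  define V where "V = (\<lambda>(u, v). (x, u, w, v)) -` \<Omega>"
  have "open V"
    unfolding V_def case_prod_unfold by (intro continuous_open_vimage open_\<Omega> continuous_intros)
  moreover have "(y, E) \<in> V"
    using p by (simp add: V_def)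
  ultimately obtain A B where AB: "open A" "open B" "y \<in> A" "E \<in> B" "A \<times> B \<subseteq> V"
    by (elim open_prod_elim) auto
  obtain d1 d2 where d: "d1 > 0" "ball y d1 \<subseteq> A" "d2 > 0" "ball E d2 \<subseteq> B"
    using AB by (metis openE)
  define d where "d = min d1 d2"
  have in_\<Omega>: "(x, u, w, v) \<in> \<Omega>" if "\<bar>u - y\<bar> < d" "\<bar>v - E\<bar> < d" for u v
  proof -
    have "u \<in> A" "v \<in> B"
      using that d by (auto simp: d_def dist_real_def abs_minus_commute subset_iff)
    then show ?thesis
      using AB(5) by (auto simp: V_def)
  qed
  have "\<psi> (x, u, w, v) = \<psi> (x, u, w, E) / E * v" if u: "\<bar>u - y\<bar> < d" and v: "\<bar>v - E\<bar> < d" for u v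
  proof -
    have "((\<lambda>t. \<psi> (x, u, w, t) / t) has_real_derivative 0) (at t within ball E d)" if "t \<in> ball E d" for t
    proof -
      have t: "(x, u, w, t) \<in> \<Omega>"
        using that u by (intro in_\<Omega>) (auto simp: dist_real_def abs_minus_commute)
      then have "t \<noteq> 0"
        using \<Omega>_subset by blast
      \<comment> \<open>A jet over the given point, with derivative coordinates set to 0, to apply
        the jet-space differentiability result.\<close>
      define J where "J = (\<lambda>_. 0 :: real)(jx := x, jy := u, jw := w, jE := t)"
      have J: "base (J(jE := s)) = (x, u, w, s)" "base J = (x, u, w, t)" "J jE = t" for s
        by (simp_all add: J_def base_def)
      have "((\<lambda>t. \<psi> (x, u, w, t)) has_real_derivative \<psi> (x, u, w, t) / t) (at t)"
        using has_derivative_partial_base[OF analytic(3), of J jE] t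
        by (simp add: J partial_def determining_equations(1)[OF t gen])
      from DERIV_divide[OF this DERIV_ident] \<open>t \<noteq> 0\<close> show ?thesis
        by (simp add: has_field_derivative_at_within)
    qed
    then have "\<exists>c. \<forall>t\<in>ball E d. \<psi> (x, u, w, t) / t = c"
      by (intro has_field_derivative_zero_constant convex_ball)
    then obtain c where "\<And>t. t \<in> ball E d \<Longrightarrow> \<psi> (x, u, w, t) / t = c"
      by blast
    then have "\<psi> (x, u, w, v) / v = \<psi> (x, u, w, E) / E"
      using v by (simp add: dist_real_def abs_minus_commute)
    moreover have "v \<noteq> 0"
      using \<Omega>_subset in_\<Omega>[OF u v] by blast
    ultimately show ?thesis
      by (simp add: divide_eq_eq)
  qed
  moreover have "d > 0"
    using d by (simp add: d_def)
  ultimately show ?thesis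
    using in_\<Omega> by (intro exI[of _ d] conjI allI impI)
qed

text \<open>By \<open>linear_in_E\<close>, \<psi> is \<open>h * v\<close> with the value
  \<open>v\<close> of E varying in an interval and everything else fixed. The second determining
  equation then becomes affine in \<open>v\<close>, so both its coefficients vanish.\<close>

lemma \<psi>_unique:
  assumes p: "(x, y, w, E) \<in> \<Omega>"
    and gen: "nonclassical_generator \<Omega> \<xi> \<phi> \<psi>"
  shows "\<psi> (x, y, w, E) = - (k\<^sup>2 + 1) * (k * x + y) * deriv \<mu> w * E"
proof -
  obtain d where d: "d > 0" and lin: "\<And>u v. \<bar>u - y\<bar> < d \<Longrightarrow> \<bar>v - E\<bar> < d \<Longrightarrow>
      (x, u, w, v) \<in> \<Omega> \<and> \<psi> (x, u, w, v) = \<psi> (x, u, w, E) / E * v"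
    using linear_in_E[OF p gen] by metis
  define h where "h = \<psi> (x, y, w, E) / E"
  define hy where "hy = deriv (\<lambda>t. \<psi> (x, t, w, E) / E) y"
  define q where "q = (k\<^sup>2 + 1) * (k * x + y) * deriv \<mu> w"
  define \<alpha> where "\<alpha> = (k\<^sup>2 + 1) * \<mu> w * h + (k\<^sup>2 + 1) * (k * x + y) * \<mu> w * hy
    + 2 * (k\<^sup>2 + 1)\<^sup>2 * (k * x + y) * \<mu> w * deriv \<mu> w"
  have E: "E \<noteq> 0"
    using \<Omega>_subset[OF p] by blast
  have affine: "\<alpha> * v = h + q" if v: "\<bar>v - E\<bar> < d" for v
  proof -
    have pv: "(x, y, w, v) \<in> \<Omega>" and \<psi>v: "\<psi> (x, y, w, v) = h * v"
      using lin[of y v] v d by (simp_all add: h_def)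
    have v0: "v \<noteq> 0"
      using \<Omega>_subset[OF pv] by blast
    have "\<forall>\<^sub>F t in nhds y. t \<in> ball y d"
      using d by (intro eventually_nhds_in_open) auto
    then have "\<forall>\<^sub>F t in nhds y. \<psi> (x, t, w, v) = \<psi> (x, t, w, E) / E * v"
    proof eventually_elim
      fix t assume "t \<in> ball y d"
      then have "\<bar>t - y\<bar> < d"
        by (simp add: dist_real_def abs_minus_commute)
      from lin[OF this v] show "\<psi> (x, t, w, v) = \<psi> (x, t, w, E) / E * v"
        by (rule conjunct2)
    qed
    then have "deriv (\<lambda>t. \<psi> (x, t, w, v)) y = deriv (\<lambda>t. \<psi> (x, t, w, E) / E * v) y"
      by (intro deriv_cong_ev refl)
    also have "\<dots> = hy * v"
    proof -
      define J where "J = (\<lambda>_. 0 :: real)(jx := x, jy := y, jw := w, jE := E)"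
      have J: "base (J(jy := s)) = (x, s, w, E)" "base J = (x, y, w, E)" "J jy = y" for s
        by (simp_all add: J_def base_def)
      have "((\<lambda>t. \<psi> (x, t, w, E)) has_real_derivative deriv (\<lambda>t. \<psi> (x, t, w, E)) y) (at y)"
        using has_derivative_partial_base[OF analytic(3), of J jy] p
        by (simp add: J partial_def)
      from DERIV_cdivide[OF this, of E]
      have D: "((\<lambda>t. \<psi> (x, t, w, E) / E) has_real_derivative hy) (at y)"
        unfolding hy_def by (simp only: DERIV_imp_deriv)
      show ?thesis
        by (rule DERIV_imp_deriv[OF DERIV_cmult_right[OF D]])
    qed
    finally show ?thesis
      using determining_equations(2)[OF pv gen] v0 \<psi>v
      by (simp add: \<alpha>_def q_def algebra_simps)
  qed
  \<comment> \<open>Two distinct values of \<open>v\<close> force \<alpha> = 0, hence h + q =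
    0.\<close>
  have "\<alpha> * E = h + q" "\<alpha> * (E + d / 2) = h + q"
    using d by (auto intro!: affine)
  then have "h + q = 0"
    using d by (simp add: distrib_left)
  then show ?thesis
    using E by (simp add: h_def q_def field_simps)
qed

end

section \<open>Analyticity of the coefficients and the conclusion\<close>

lemma real_analytic_on_linear_mult:
  fixes f :: "base_point \<Rightarrow> real"
  assumes "f real_analytic_on S"
  shows "(\<lambda>(x, y, w, E). (k * x + y) * f (x, y, w, E)) real_analytic_on S"
    and "(\<lambda>(x, y, w, E). E * f (x, y, w, E)) real_analytic_on S"
proof -
  have B: "(1, 0, 0, 0) \<in> (Basis :: base_point set)" "(0, 1, 0, 0) \<in> (Basis :: base_point set)"
    "(0, 0, 0, 1) \<in> (Basis :: base_point set)"
    by (auto simp: Basis_prod_def zero_prod_def)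
  have "(\<lambda>p. k * ((p \<bullet> (1, 0, 0, 0)) * f p) + (p \<bullet> (0, 1, 0, 0)) * f p) real_analytic_on S"
    by (intro real_analytic_on_add real_analytic_on_cmult real_analytic_on_mult_coord B assms)
  then show "(\<lambda>(x, y, w, E). (k * x + y) * f (x, y, w, E)) real_analytic_on S"
    by (simp add: case_prod_unfold inner_prod_def algebra_simps)
  show "(\<lambda>(x, y, w, E). E * f (x, y, w, E)) real_analytic_on S"
    using real_analytic_on_mult_coord[OF assms B(3)]
    by (simp add: case_prod_unfold inner_prod_def)
qed

lemma real_analytic_on_compose_w:
  assumes "\<mu> real_analytic_on I" "\<And>x y w E. (x, y, w, E) \<in> S \<Longrightarrow> w \<in> I"
  shows "(\<lambda>(x, y, w, E). \<mu> w) real_analytic_on (S :: base_point set)"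
proof -
  have "(\<lambda>p. \<mu> (p \<bullet> (0, 0, 1, 0))) real_analytic_on S"
    using assms by (intro real_analytic_on_compose_coord[of \<mu> I])
      (auto simp: Basis_prod_def zero_prod_def inner_prod_def)
  then show ?thesis
    by (simp add: case_prod_unfold inner_prod_def)
qed

theorem proposition9:
  fixes k :: real and \<mu> :: "real \<Rightarrow> real" and I :: "real set" and \<Omega> :: "base_point set"
  assumes "k \<noteq> 0"
    and "open I" and "\<mu> real_analytic_on I" and "\<not> \<mu> constant_on I"
    and "open \<Omega>" and "\<forall>(x, y, w, E)\<in>\<Omega>. w \<in> I \<and> E \<noteq> 0"
  shows "let \<xi>0 = (\<lambda>(x, y, w, E). k);
             \<phi>0 = (\<lambda>(x, y, w, E). (k\<^sup>2 + 1) * (k * x + y) * \<mu> w);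
             \<psi>0 = (\<lambda>(x, y, w, E). - (k\<^sup>2 + 1) * (k * x + y) * deriv \<mu> w * E)
         in nonclassical_generator \<Omega> \<xi>0 \<phi>0 \<psi>0 \<and>
            (\<forall>\<xi> \<phi> \<psi>. nonclassical_generator \<Omega> \<xi> \<phi> \<psi> \<and>
                (\<forall>p\<in>\<Omega>. \<xi> p = \<xi>0 p \<and> \<phi> p = \<phi>0 p) \<longrightarrow>
              (\<forall>p\<in>\<Omega>. \<psi> p = \<psi>0 p))"
proof -
  define \<xi>0 :: "base_point \<Rightarrow> real" where "\<xi>0 = (\<lambda>(x, y, w, E). k)"
  define \<phi>0 :: "base_point \<Rightarrow> real" where "\<phi>0 = (\<lambda>(x, y, w, E). (k\<^sup>2 + 1) * (k * x + y) * \<mu> w)"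
  define \<psi>0 :: "base_point \<Rightarrow> real"
    where "\<psi>0 = (\<lambda>(x, y, w, E). - (k\<^sup>2 + 1) * (k * x + y) * deriv \<mu> w * E)"
  have \<Omega>: "w \<in> I \<and> E \<noteq> 0" if "(x, y, w, E) \<in> \<Omega>" for x y w E
    using assms(6) that by blast
  have \<mu>w: "(\<lambda>(x, y, w, E). \<mu> w) real_analytic_on \<Omega>"
    "(\<lambda>(x, y, w, E). deriv \<mu> w) real_analytic_on \<Omega>"
    using real_analytic_on_compose_w[of _ I \<Omega>] assms(3) real_analytic_on_deriv(1) \<Omega> by blast+
  have an: "\<xi>0 real_analytic_on \<Omega>" "\<phi>0 real_analytic_on \<Omega>" "\<psi>0 real_analytic_on \<Omega>"
  proof -
    show "\<xi>0 real_analytic_on \<Omega>"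
      using real_analytic_on_const[of k \<Omega>] by (simp add: \<xi>0_def case_prod_unfold)
    show "\<phi>0 real_analytic_on \<Omega>"
      using real_analytic_on_cmult[OF real_analytic_on_linear_mult(1)[OF \<mu>w(1)], of "k\<^sup>2 + 1" k]
      by (simp add: \<phi>0_def case_prod_unfold mult.assoc)
    show "\<psi>0 real_analytic_on \<Omega>"
      using real_analytic_on_cmult[OF real_analytic_on_linear_mult(1)[OF
          real_analytic_on_linear_mult(2)[OF \<mu>w(2)]], of "- (k\<^sup>2 + 1)" k]
      by (simp add: \<psi>0_def case_prod_unfold mult_ac)
  qed
  \<comment> \<open>Existence: the ansatz with the claimed \<psi>.\<close>
  interpret nonclassical_ansatz k \<mu> I \<Omega> \<xi>0 \<phi>0 \<psi>0
    using assms(3,5) \<Omega> an by unfold_locales (auto simp: \<xi>0_def \<phi>0_def)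
  have "pr2 \<xi>0 (\<lambda>_. 1) \<phi>0 \<psi>0 pde J = 0"
    if "base J \<in> \<Omega>" "surf_w \<xi>0 \<phi>0 J = 0" "surf_E \<xi>0 \<psi>0 J = 0" for J
    using that by (rule pr2_pde_eq_0) (simp add: \<psi>0_def)
  then have "nonclassical_generator \<Omega> \<xi>0 \<phi>0 \<psi>0"
    unfolding nonclassical_generator_def using an assms(5,6) pr1_surf by blast
  moreover have "\<psi> p = \<psi>0 p"
    if gen: "nonclassical_generator \<Omega> \<xi> \<phi> \<psi>" and eq: "\<forall>p\<in>\<Omega>. \<xi> p = \<xi>0 p \<and> \<phi> p = \<phi>0 p"
      and p: "p \<in> \<Omega>" for \<xi> \<phi> \<psi> p
  proof -
    \<comment> \<open>Uniqueness: the same ansatz for a competing generator, whose analyticity is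
      part of being a generator.\<close>
    interpret gen: nonclassical_ansatz k \<mu> I \<Omega> \<xi> \<phi> \<psi>
      using assms(3,5) \<Omega> gen eq
      by unfold_locales (auto simp: nonclassical_generator_def \<xi>0_def \<phi>0_def)
    show ?thesis
      using gen.\<psi>_unique[OF _ gen] p unfolding \<psi>0_def by (cases p) simp
  qed
  ultimately show ?thesis
    unfolding Let_def \<xi>0_def[symmetric] \<phi>0_def[symmetric] \<psi>0_def[symmetric] by blast
qed

end
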